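(* Let $K$ be a field, let $E$ be a finite directed graph without sinks and let $F$ be a nontrivial finite directed graph with a source. If $L_K(E)$ has IBN, then $L_K(E\times F)$ has IBN; and if $L_K(E)$ has gr-IBN, then $L_K(E\times F)$ has gr-IBN.
   Context: A directed graph $E=(E^0,E^1,s,r)$ consists of disjoint sets $E^0$ (vertices) and $E^1$ (edges) with maps $s,r:E^1\to E^0$ (source, range). It is finite if $E^0$ and $E^1$ are finite. A sink is a vertex $v$ with $s^{-1}(v)=\emptyset$; a source is a vertex $v$ with $r^{-1}(v)=\emptyset$; a vertex $v$ is regular if $0<|s^{-1}(v)|<\infty$. "Nontrivial" means having more than one vertex. The Cartesian product $E\times F$ of finite graphs $E,F$ is the graph with vertex set $E^0\times F^0$, edge set $(E^1\times F^0)\cup(E^0\times F^1)$, and $s(e,v)=(s_E(e),v)$, $r(e,v)=(r_E(e),v)$ for $(e,v)\in E^1\times F^0$, $s(u,f)=(u,s_F(f))$, $r(u,f)=(u,r_F(f))$ for $(u,f)\in E^0\times F^1$. The Leavitt path algebra $L_K(E)$ is the $K$-algebra generated by $E^0\cup E^1\cup\{e^*\mid e\in E^1\}$ subject to, for all $v,w\in E^0$ and $e,f\in E^1$: (1) $vw=\delta_{v,w}w$; (2) $s(e)e=e=er(e)$ and $r(e)e^*=e^*=e^*s(e)$; (3) $e^*f=\delta_{e,f}r(e)$; (4) $v=\sum_{e\in s^{-1}(v)}ee^*$ for every regular vertex $v$. It is $\mathbb{Z}$-graded with $\deg v=0$, $\deg e=1$, $\deg e^*=-1$. A ring $R$ has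 IBN (Invariant Basis Number) if for all positive integers $m,n$, $R^m\cong R^n$ as right $R$-modules implies $m=n$. For an abelian group $\Gamma$, a $\Gamma$-graded ring $R$ and $\delta\in\Gamma$, the shifted graded right module $R(\delta)$ has components $R(\delta)_\gamma=R_{\delta+\gamma}$; $\cong_{gr}$ denotes isomorphism of right modules preserving degrees. $R$ has gr-IBN (Graded Invariant Basis Number) if for all positive integers $m,n$ and all $\alpha_1,\dots,\alpha_m,\beta_1,\dots,\beta_n\in\Gamma$, $R(\alpha_1)\oplus\cdots\oplus R(\alpha_m)\cong_{gr}R(\beta_1)\oplus\cdots\oplus R(\beta_n)$ as graded right $R$-modules implies $m=n$. *)

theory Defs
  imports
    "Graph_Theory.Digraph"
    "HOL-Library.FuncSet"
    "HOL-Library.Poly_Mapping"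
    "HOL-Algebra.Module"
begin

section \<open>Directed graphs\<close>

definition is_sink :: "('v, 'e) pre_digraph \<Rightarrow> 'v \<Rightarrow> bool" where
  "is_sink G v \<longleftrightarrow> v \<in> verts G \<and> out_arcs G v = {}"

definition is_source :: "('v, 'e) pre_digraph \<Rightarrow> 'v \<Rightarrow> bool" where
  "is_source G v \<longleftrightarrow> v \<in> verts G \<and> in_arcs G v = {}"

definition is_regular :: "('v, 'e) pre_digraph \<Rightarrow> 'v \<Rightarrow> bool" where
  "is_regular G v \<longleftrightarrow> v \<in> verts G \<and> out_arcs G v \<noteq> {} \<and> finite (out_arcs G v)"

definition cartesian_product ::
  "('v, 'e) pre_digraph \<Rightarrow> ('w, 'f) pre_digraph \<Rightarrow> ('v \<times> 'w, 'e \<times> 'w + 'v \<times> 'f) pre_digraph"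
where
  "cartesian_product E F =
    \<lparr> verts = verts E \<times> verts F,
      arcs = (arcs E \<times> verts F) <+> (verts E \<times> arcs F),
      tail = case_sum (\<lambda>(e, v). (tail E e, v)) (\<lambda>(u, f). (u, tail F f)),
      head = case_sum (\<lambda>(e, v). (head E e, v)) (\<lambda>(u, f). (u, head F f)) \<rparr>"


section \<open>Free algebras\<close>

text \<open>
  With words under concatenation as a monoid, the type of finitely supported functions
  \<open>'x fword \<Rightarrow>\<^sub>0 'k\<close> with its convolution product is the free unital associative
  \<open>'k\<close>-algebra on \<open>'x\<close>.
\<close>

datatype 'x fword = FWord (letters: "'x list")

instantiation fword :: (type) monoid_add
begin

definition zero_fword :: "'x fword" where
  "zero_fword = FWord []"

definition plus_fword :: "'x fword \<Rightarrow> 'x fword \<Rightarrow> 'x fword" where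
  "plus_fword u w = FWord (letters u @ letters w)"

instance
  by standard (auto simp: zero_fword_def plus_fword_def)

end

definition free_gen :: "'x \<Rightarrow> ('x fword \<Rightarrow>\<^sub>0 'k::field)" where
  "free_gen x = Poly_Mapping.single (FWord [x]) 1"

definition free_scale :: "'k::field \<Rightarrow> ('x fword \<Rightarrow>\<^sub>0 'k) \<Rightarrow> ('x fword \<Rightarrow>\<^sub>0 'k)" where
  "free_scale c p = Poly_Mapping.single 0 c * p"

text \<open>
  The free algebra on \<open>X\<close> is taken without unit (no empty word).
  A presentation of an algebra by generators and relations is to be read in this non-unital
  sense: starting from the unital free algebra, the vertex, edge and ghost edge relations would
  instead present the unitization of the Leavitt path algebra.
\<close>

definition free_algebra :: "'x set \<Rightarrow> ('x fword \<Rightarrow>\<^sub>0 'k::field) set" where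
  "free_algebra X = {p. \<forall>w \<in> Poly_Mapping.keys p. w \<noteq> 0 \<and> set (letters w) \<subseteq> X}"

inductive_set algebra_ideal ::
  "'x set \<Rightarrow> ('x fword \<Rightarrow>\<^sub>0 'k::field) set \<Rightarrow> ('x fword \<Rightarrow>\<^sub>0 'k) set"
  for X and S
where
  base: "p \<in> S \<Longrightarrow> p \<in> algebra_ideal X S"
| zero: "0 \<in> algebra_ideal X S"
| add: "p \<in> algebra_ideal X S \<Longrightarrow> q \<in> algebra_ideal X S \<Longrightarrow> p + q \<in> algebra_ideal X S"
| scale: "p \<in> algebra_ideal X S \<Longrightarrow> free_scale c p \<in> algebra_ideal X S"
| mult_left: "a \<in> free_algebra X \<Longrightarrow> p \<in> algebra_ideal X S \<Longrightarrow> a * p \<in> algebra_ideal X S"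
| mult_right: "p \<in> algebra_ideal X S \<Longrightarrow> a \<in> free_algebra X \<Longrightarrow> p * a \<in> algebra_ideal X S"

definition algebra_cong ::
  "'x set \<Rightarrow> ('x fword \<Rightarrow>\<^sub>0 'k::field) set \<Rightarrow> (('x fword \<Rightarrow>\<^sub>0 'k) \<times> ('x fword \<Rightarrow>\<^sub>0 'k)) set"
where
  "algebra_cong X S =
    {(p, q). p \<in> free_algebra X \<and> q \<in> free_algebra X \<and> p - q \<in> algebra_ideal X S}"


section \<open>Leavitt path algebras\<close>

datatype ('v, 'e) lpa_gen = Vertex 'v | Edge 'e | Ghost 'e

definition lpa_gens :: "('v, 'e) pre_digraph \<Rightarrow> ('v, 'e) lpa_gen set" where
  "lpa_gens E = Vertex ` verts E \<union> Edge ` arcs E \<union> Ghost ` arcs E"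

type_synonym ('v, 'e, 'k) lpa_free = "('v, 'e) lpa_gen fword \<Rightarrow>\<^sub>0 'k"

abbreviation lpa_v :: "'v \<Rightarrow> ('v, 'e, 'k::field) lpa_free" where
  "lpa_v v \<equiv> free_gen (Vertex v)"

abbreviation lpa_e :: "'e \<Rightarrow> ('v, 'e, 'k::field) lpa_free" where
  "lpa_e e \<equiv> free_gen (Edge e)"

abbreviation lpa_g :: "'e \<Rightarrow> ('v, 'e, 'k::field) lpa_free" where
  "lpa_g e \<equiv> free_gen (Ghost e)"

text \<open>A defining relation \<open>p = q\<close> is represented by the element \<open>p - q\<close>.\<close>

inductive_set lpa_relations :: "('v, 'e) pre_digraph \<Rightarrow> ('v, 'e, 'k::field) lpa_free set"
  for E
where
  vertex: "v \<in> verts E \<Longrightarrow> w \<in> verts E \<Longrightarrow>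
    lpa_v v * lpa_v w - (if v = w then lpa_v w else 0) \<in> lpa_relations E"
| edge_tail: "e \<in> arcs E \<Longrightarrow> lpa_v (tail E e) * lpa_e e - lpa_e e \<in> lpa_relations E"
| edge_head: "e \<in> arcs E \<Longrightarrow> lpa_e e * lpa_v (head E e) - lpa_e e \<in> lpa_relations E"
| ghost_head: "e \<in> arcs E \<Longrightarrow> lpa_v (head E e) * lpa_g e - lpa_g e \<in> lpa_relations E"
| ghost_tail: "e \<in> arcs E \<Longrightarrow> lpa_g e * lpa_v (tail E e) - lpa_g e \<in> lpa_relations E"
| CK1: "e \<in> arcs E \<Longrightarrow> f \<in> arcs E \<Longrightarrow>
    lpa_g e * lpa_e f - (if e = f then lpa_v (head E e) else 0) \<in> lpa_relations E"
| CK2: "is_regular E v \<Longrightarrow>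
    lpa_v v - (\<Sum>e \<in> out_arcs E v. lpa_e e * lpa_g e) \<in> lpa_relations E"

definition lpa_cong ::
  "('v, 'e) pre_digraph \<Rightarrow> (('v, 'e, 'k::field) lpa_free \<times> ('v, 'e, 'k) lpa_free) set"
where
  "lpa_cong E = algebra_cong (lpa_gens E) (lpa_relations E)"

abbreviation lpa_class ::
  "('v, 'e) pre_digraph \<Rightarrow> ('v, 'e, 'k::field) lpa_free \<Rightarrow> ('v, 'e, 'k) lpa_free set"
where
  "lpa_class E p \<equiv> lpa_cong E `` {p}"

text \<open>
  The elements are the residue classes of the free algebra modulo the ideal generated by the
  relations. The field \<open>one\<close> is the sum of the vertices, which is the identity when
  there are finitely many of them.
\<close>

definition leavitt_path_algebra ::
  "'k::field itself \<Rightarrow> ('v, 'e) pre_digraph \<Rightarrow> ('k, ('v, 'e, 'k) lpa_free set) module"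
where
  "leavitt_path_algebra _ E =
    \<lparr> carrier = free_algebra (lpa_gens E) // lpa_cong E,
      mult = (\<lambda>P Q. \<Union>p \<in> P. \<Union>q \<in> Q. lpa_class E (p * q)),
      one = lpa_class E (\<Sum>v \<in> verts E. lpa_v v),
      zero = lpa_class E 0,
      add = (\<lambda>P Q. \<Union>p \<in> P. \<Union>q \<in> Q. lpa_class E (p + q)),
      smult = (\<lambda>c P. \<Union>p \<in> P. lpa_class E (free_scale c p)) \<rparr>"

fun gen_degree :: "('v, 'e) lpa_gen \<Rightarrow> int" where
  "gen_degree (Vertex v) = 0"
| "gen_degree (Edge e) = 1"
| "gen_degree (Ghost e) = - 1"

definition word_degree :: "('v, 'e) lpa_gen fword \<Rightarrow> int" where
  "word_degree w = (\<Sum>x \<leftarrow> letters w. gen_degree x)"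

definition lpa_component ::
  "'k::field itself \<Rightarrow> ('v, 'e) pre_digraph \<Rightarrow> int \<Rightarrow> ('v, 'e, 'k) lpa_free set set"
where
  "lpa_component _ E d =
    lpa_class E ` {p \<in> free_algebra (lpa_gens E). \<forall>w \<in> Poly_Mapping.keys p. word_degree w = d}"


section \<open>Right modules and invariant basis number\<close>

text \<open>
  The library's modules are left modules over commutative rings, so right modules over a possibly
  noncommutative ring are given their own structure.
\<close>

record ('r, 'm) right_module = "'m partial_object" +
  radd :: "'m \<Rightarrow> 'm \<Rightarrow> 'm"
  ract :: "'m \<Rightarrow> 'r \<Rightarrow> 'm"

definition right_module_iso ::
  "('r, 'x) ring_scheme \<Rightarrow> ('r, 'm) right_module \<Rightarrow> ('r, 'n) right_module \<Rightarrow> ('m \<Rightarrow> 'n) set"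
where
  "right_module_iso R M N =
    {h. bij_betw h (carrier M) (carrier N) \<and>
        (\<forall>x \<in> carrier M. \<forall>y \<in> carrier M. h (radd M x y) = radd N (h x) (h y)) \<and>
        (\<forall>x \<in> carrier M. \<forall>r \<in> carrier R. h (ract M x r) = ract N (h x) r)}"

definition free_right_module ::
  "('r, 'x) ring_scheme \<Rightarrow> nat \<Rightarrow> ('r, nat \<Rightarrow> 'r) right_module"
where
  "free_right_module R n =
    \<lparr> carrier = {..<n} \<rightarrow>\<^sub>E carrier R,
      radd = (\<lambda>x y. \<lambda>i\<in>{..<n}. x i \<oplus>\<^bsub>R\<^esub> y i),
      ract = (\<lambda>x r. \<lambda>i\<in>{..<n}. x i \<otimes>\<^bsub>R\<^esub> r) \<rparr>"

definition IBN :: "('r, 'x) ring_scheme \<Rightarrow> bool" where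
  "IBN R \<longleftrightarrow>
    (\<forall>m n. 0 < m \<longrightarrow> 0 < n \<longrightarrow>
      right_module_iso R (free_right_module R m) (free_right_module R n) \<noteq> {} \<longrightarrow> m = n)"

text \<open>
  A grading on a ring or right module is the family of its homogeneous components, kept separate
  from the underlying structure: shifting changes only the family, so \<open>free_right_module R n\<close>
  also underlies every direct sum of \<open>n\<close> shifts of \<open>R\<close>.
\<close>

definition shift :: "('g::ab_group_add \<Rightarrow> 'm set) \<Rightarrow> 'g \<Rightarrow> ('g \<Rightarrow> 'm set)" where
  "shift C d = (\<lambda>g. C (d + g))"

definition direct_sum_grading ::
  "nat \<Rightarrow> (nat \<Rightarrow> 'g::ab_group_add \<Rightarrow> 'm set) \<Rightarrow> ('g \<Rightarrow> (nat \<Rightarrow> 'm) set)"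
where
  "direct_sum_grading n C = (\<lambda>g. \<Pi>\<^sub>E i\<in>{..<n}. C i g)"

definition graded_right_module_iso ::
  "('r, 'x) ring_scheme \<Rightarrow> ('r, 'm) right_module \<Rightarrow> ('g::ab_group_add \<Rightarrow> 'm set) \<Rightarrow>
    ('r, 'n) right_module \<Rightarrow> ('g \<Rightarrow> 'n set) \<Rightarrow> ('m \<Rightarrow> 'n) set"
where
  "graded_right_module_iso R M C N D =
    {h \<in> right_module_iso R M N. \<forall>g. h ` C g \<subseteq> D g}"

definition gr_IBN :: "('r, 'x) ring_scheme \<Rightarrow> ('g::ab_group_add \<Rightarrow> 'r set) \<Rightarrow> bool" where
  "gr_IBN R C \<longleftrightarrow>
    (\<forall>m n (\<alpha> :: nat \<Rightarrow> 'g) (\<beta> :: nat \<Rightarrow> 'g). 0 < m \<longrightarrow> 0 < n \<longrightarrow>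
      graded_right_module_iso R
        (free_right_module R m) (direct_sum_grading m (\<lambda>i. shift C (\<alpha> i)))
        (free_right_module R n) (direct_sum_grading n (\<lambda>i. shift C (\<beta> i))) \<noteq> {} \<longrightarrow> m = n)"

end

theory Submission
  imports Defs "HOL-Algebra.UnivPoly"
begin

text \<open>
  Let \<open>w\<close> be a source of \<open>F\<close>. No edge of \<open>E \<times> F\<close> enters the column \<open>E \<times> {w}\<close> from outside, so the
  vertices outside the column form a hereditary set. It is also saturated: as \<open>E\<close> has no sinks, every
  vertex \<open>(v, w)\<close> emits an edge that stays in the column. Hence the Leavitt path algebra of the
  column, a copy of that of \<open>E\<close>, is a quotient of that of \<open>E \<times> F\<close>. Concretely, keeping the generators
  of the column and killing all others respects the defining relations (\<open>lift_relation\<close>), and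
  gives a unital graded ring homomorphism \<open>proj\<close> from the Leavitt path algebra of
  \<open>E \<times> F\<close> to that of \<open>E\<close>.

  Both invariance properties pass from the target of such a homomorphism to its source. Indeed,
  isomorphisms between free modules of ranks \<open>m\<close> and \<open>n\<close> are the same as mutually inverse
  rectangular matrices, and a unital homomorphism applied entrywise maps inverse matrices to inverse
  matrices (\<open>IBN_pullback\<close>). A graded isomorphism between sums of shifts amounts to prescribed
  degrees of the matrix entries, and these are kept by a graded homomorphism (\<open>gr_IBN_pullback\<close>).

  Applying this needs the residue classes of the free algebra to be a unital ring. The unit is
  the sum of the vertices, and that it acts as one is checked on generators (\<open>vertex_sum_unit\<close>).
\<close>

section \<open>Invariant basis number along ring homomorphisms\<close>

text \<open>
  \<open>A\<close> is an \<open>n\<close> by \<open>m\<close> matrix and \<open>B\<close> an \<open>m\<close> by \<open>n\<close> matrix. Both are indexed by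
  functions on all of \<open>nat\<close>; only the entries inside the two rectangles are constrained.
\<close>

definition inverse_matrices ::
  "('r, 'x) ring_scheme \<Rightarrow> nat \<Rightarrow> nat \<Rightarrow> (nat \<Rightarrow> nat \<Rightarrow> 'r) \<Rightarrow> (nat \<Rightarrow> nat \<Rightarrow> 'r) \<Rightarrow> bool"
where
  "inverse_matrices R m n A B \<longleftrightarrow>
    (\<forall>i<n. \<forall>j<m. A i j \<in> carrier R \<and> B j i \<in> carrier R) \<and>
    (\<forall>j<m. \<forall>k<m. (\<Oplus>\<^bsub>R\<^esub>i\<in>{..<n}. B j i \<otimes>\<^bsub>R\<^esub> A i k) = (if j = k then \<one>\<^bsub>R\<^esub> else \<zero>\<^bsub>R\<^esub>)) \<and>
    (\<forall>i<n. \<forall>k<n. (\<Oplus>\<^bsub>R\<^esub>j\<in>{..<m}. A i j \<otimes>\<^bsub>R\<^esub> B j k) = (if i = k then \<one>\<^bsub>R\<^esub> else \<zero>\<^bsub>R\<^esub>))"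

definition matrix_vector ::
  "('r, 'x) ring_scheme \<Rightarrow> nat \<Rightarrow> nat \<Rightarrow> (nat \<Rightarrow> nat \<Rightarrow> 'r) \<Rightarrow> (nat \<Rightarrow> 'r) \<Rightarrow> (nat \<Rightarrow> 'r)"
where
  "matrix_vector R m n A x = (\<lambda>i\<in>{..<n}. \<Oplus>\<^bsub>R\<^esub>j\<in>{..<m}. A i j \<otimes>\<^bsub>R\<^esub> x j)"

definition basis_vector :: "('r, 'x) ring_scheme \<Rightarrow> nat \<Rightarrow> nat \<Rightarrow> (nat \<Rightarrow> 'r)" where
  "basis_vector R m j = (\<lambda>i\<in>{..<m}. if i = j then \<one>\<^bsub>R\<^esub> else \<zero>\<^bsub>R\<^esub>)"

lemma inverse_matrices_sym: "inverse_matrices R m n A B \<Longrightarrow> inverse_matrices R n m B A"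
  unfolding inverse_matrices_def by auto

lemma (in abelian_monoid) finsum_swap:
  assumes "finite I" and "finite J" and "\<And>i j. i \<in> I \<Longrightarrow> j \<in> J \<Longrightarrow> f i j \<in> carrier G"
  shows "(\<Oplus>i\<in>I. \<Oplus>j\<in>J. f i j) = (\<Oplus>j\<in>J. \<Oplus>i\<in>I. f i j)"
  using assms
proof (induction I rule: finite_induct)
  case empty
  then show ?case by simp
next
  case (insert a I)
  then have "(\<Oplus>i\<in>insert a I. \<Oplus>j\<in>J. f i j) = (\<Oplus>j\<in>J. f a j) \<oplus> (\<Oplus>j\<in>J. \<Oplus>i\<in>I. f i j)"
    by (subst finsum_insert) (auto intro!: finsum_closed)
  also have "\<dots> = (\<Oplus>j\<in>J. f a j \<oplus> (\<Oplus>i\<in>I. f i j))"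
    using insert.prems by (intro finsum_addf[symmetric]) (auto intro!: finsum_closed)
  also have "\<dots> = (\<Oplus>j\<in>J. \<Oplus>i\<in>insert a I. f i j)"
    using insert by (intro finsum_cong') (auto intro!: finsum_closed simp: finsum_insert Pi_def)
  finally show ?case .
qed

context ring
begin

lemma finsum_delta_mult:
  fixes j m :: nat
  assumes "j < m" and "\<And>i. i < m \<Longrightarrow> a i \<in> carrier R"
  shows "(\<Oplus>i\<in>{..<m}. (if j = i then \<one> else \<zero>) \<otimes> a i) = a j"
proof -
  have "(\<Oplus>i\<in>{..<m}. (if j = i then \<one> else \<zero>) \<otimes> a i) = (\<Oplus>i\<in>{..<m}. if j = i then a i else \<zero>)"
    using assms by (intro finsum_cong') auto
  also have "\<dots> = a j"
    using assms by (intro finsum_singleton) auto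
  finally show ?thesis .
qed

lemma basis_vector_in_free:
  "basis_vector R m j \<in> carrier (free_right_module R m)"
  by (auto simp: basis_vector_def free_right_module_def)

text \<open>
  An isomorphism is additive and respects the right action, so it acts on columns as left
  multiplication by the matrix of its values on the basis. Preservation of zero is not among the
  defining conditions; it comes from \<open>0 = 0 \<cdot> 0\<close>, where the right factor is the zero scalar.
\<close>

lemma right_module_iso_matrix:
  assumes h: "h \<in> right_module_iso R (free_right_module R m) (free_right_module R n)"
    and x: "x \<in> carrier (free_right_module R m)" and i: "i < n"
  shows "h x i = (\<Oplus>j\<in>{..<m}. h (basis_vector R m j) i \<otimes> x j)"
proof -
  let ?M = "free_right_module R m" and ?N = "free_right_module R n"
  have carrier: "h y \<in> carrier ?N" if "y \<in> carrier ?M" for y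
    using h that by (auto simp: right_module_iso_def bij_betw_def)
  have entry: "h y i \<in> carrier R" if "y \<in> carrier ?M" for y
    using carrier[OF that] i by (auto simp: free_right_module_def)
  have xc: "x j \<in> carrier R" if "j < m" for j
    using x that by (auto simp: free_right_module_def)
  \<comment> \<open>Cutting off \<open>x\<close> after its first \<open>k\<close> entries allows an induction that adds one basis term at a time.\<close>
  define trunc where "trunc k = (\<lambda>j\<in>{..<m}. if j < k then x j else \<zero>)" for k
  have trunc: "trunc k \<in> carrier ?M" for k
    using xc by (auto simp: trunc_def free_right_module_def)
  have "h (trunc k) i = (\<Oplus>j\<in>{..<k}. h (basis_vector R m j) i \<otimes> x j)" if "k \<le> m" for k
    using that
  proof (induction k)
    case 0
    have "trunc 0 = ract ?M (trunc 0) \<zero>"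
      by (auto simp: trunc_def free_right_module_def fun_eq_iff)
    moreover have "h (ract ?M (trunc 0) \<zero>) = ract ?N (h (trunc 0)) \<zero>"
      using h trunc[of 0] unfolding right_module_iso_def by blast
    ultimately have "h (trunc 0) = ract ?N (h (trunc 0)) \<zero>"
      by simp
    then have "h (trunc 0) i = ract ?N (h (trunc 0)) \<zero> i"
      by simp
    then show ?case
      using i entry[OF trunc] by (simp add: free_right_module_def)
  next
    case (Suc k)
    let ?b = "basis_vector R m k"
    have b: "?b \<in> carrier ?M" by (rule basis_vector_in_free)
    have bx: "ract ?M ?b (x k) \<in> carrier ?M"
      using xc[of k] Suc.prems by (auto simp: free_right_module_def basis_vector_def)
    have "trunc (Suc k) = radd ?M (ract ?M ?b (x k)) (trunc k)"
      using xc xc[of k] Suc.prems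
      by (auto simp: trunc_def free_right_module_def basis_vector_def fun_eq_iff less_Suc_eq)
    then have "h (trunc (Suc k)) = radd ?N (ract ?N (h ?b) (x k)) (h (trunc k))"
      using h trunc[of k] b bx xc[of k] Suc.prems by (simp add: right_module_iso_def)
    then have "h (trunc (Suc k)) i = h ?b i \<otimes> x k \<oplus> h (trunc k) i"
      using i by (simp add: free_right_module_def)
    moreover have "(\<Oplus>j\<in>{..<Suc k}. h (basis_vector R m j) i \<otimes> x j)
        = h ?b i \<otimes> x k \<oplus> (\<Oplus>j\<in>{..<k}. h (basis_vector R m j) i \<otimes> x j)"
      unfolding lessThan_Suc
      using Suc.prems xc entry basis_vector_in_free by (intro finsum_insert) (auto simp: Pi_def)
    ultimately show ?case
      using Suc by simp
  qed
  moreover have "trunc m = x"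
    using x by (auto simp: trunc_def free_right_module_def fun_eq_iff PiE_def extensional_def)
  ultimately show ?thesis
    by force
qed

lemma right_module_iso_inv_into:
  assumes h: "h \<in> right_module_iso R (free_right_module R m) (free_right_module R n)"
  shows "inv_into (carrier (free_right_module R m)) h
    \<in> right_module_iso R (free_right_module R n) (free_right_module R m)"
proof -
  let ?M = "free_right_module R m" and ?N = "free_right_module R n"
  let ?k = "inv_into (carrier ?M) h"
  have bij: "bij_betw h (carrier ?M) (carrier ?N)"
    and hadd: "\<And>x y. x \<in> carrier ?M \<Longrightarrow> y \<in> carrier ?M \<Longrightarrow> h (radd ?M x y) = radd ?N (h x) (h y)"
    and hact: "\<And>x r. x \<in> carrier ?M \<Longrightarrow> r \<in> carrier R \<Longrightarrow> h (ract ?M x r) = ract ?N (h x) r"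
    using h by (auto simp: right_module_iso_def)
  have addM: "radd ?M x y \<in> carrier ?M" if "x \<in> carrier ?M" "y \<in> carrier ?M" for x y
    using that by (auto simp: free_right_module_def PiE_def Pi_def)
  have actM: "ract ?M x r \<in> carrier ?M" if "x \<in> carrier ?M" "r \<in> carrier R" for x r
    using that by (auto simp: free_right_module_def PiE_def Pi_def)
  have k: "?k y \<in> carrier ?M" "h (?k y) = y" if "y \<in> carrier ?N" for y
    using bij that by (auto simp: bij_betw_def inv_into_into f_inv_into_f)
  have kh: "?k (h x) = x" if "x \<in> carrier ?M" for x
    using bij that by (auto simp: bij_betw_def)
  have "?k (radd ?N x y) = radd ?M (?k x) (?k y)" if "x \<in> carrier ?N" "y \<in> carrier ?N" for x y
    using kh[OF addM[OF k(1)[OF that(1)] k(1)[OF that(2)]]] that by (simp add: hadd k)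
  moreover have "?k (ract ?N x r) = ract ?M (?k x) r" if "x \<in> carrier ?N" "r \<in> carrier R" for x r
    using kh[OF actM[OF k(1)[OF that(1)] that(2)]] that by (simp add: hact k)
  ultimately show ?thesis
    using bij by (simp add: right_module_iso_def bij_betw_inv_into)
qed

text \<open>
  The columns of the second matrix are the values of the inverse isomorphism on the basis of the
  target. Evaluating the two composites, which are identities, on basis vectors gives the two
  matrix products.
\<close>

lemma right_module_iso_imp_inverse_matrices:
  assumes h: "h \<in> right_module_iso R (free_right_module R m) (free_right_module R n)"
  shows "\<exists>B. inverse_matrices R m n (\<lambda>i j. h (basis_vector R m j) i) B"
proof -
  let ?M = "free_right_module R m" and ?N = "free_right_module R n"
  define k where "k = inv_into (carrier ?M) h"
  have k: "k \<in> right_module_iso R ?N ?M"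
    unfolding k_def using h by (rule right_module_iso_inv_into)
  have hc: "h x \<in> carrier ?N" and kh: "k (h x) = x" if "x \<in> carrier ?M" for x
    using h that by (auto simp: right_module_iso_def bij_betw_def k_def)
  have kc: "k y \<in> carrier ?M" and hk: "h (k y) = y" if "y \<in> carrier ?N" for y
    using h that by (auto simp: right_module_iso_def bij_betw_def k_def inv_into_into f_inv_into_f)
  let ?A = "\<lambda>i j. h (basis_vector R m j) i" and ?B = "\<lambda>j i. k (basis_vector R n i) j"
  have "?A i j \<in> carrier R \<and> ?B j i \<in> carrier R" if "i < n" "j < m" for i j
    using hc[OF basis_vector_in_free[of m j]] kc[OF basis_vector_in_free[of n i]] that
    by (auto simp: free_right_module_def)
  moreover have "(\<Oplus>i\<in>{..<n}. ?B j i \<otimes> ?A i l) = (if j = l then \<one> else \<zero>)"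
    if "j < m" "l < m" for j l
    using right_module_iso_matrix[OF k hc[OF basis_vector_in_free[of m l]] that(1)]
      kh[OF basis_vector_in_free[of m l]] that by (simp add: basis_vector_def)
  moreover have "(\<Oplus>j\<in>{..<m}. ?A i j \<otimes> ?B j l) = (if i = l then \<one> else \<zero>)"
    if "i < n" "l < n" for i l
    using right_module_iso_matrix[OF h kc[OF basis_vector_in_free[of n l]] that(1)]
      hk[OF basis_vector_in_free[of n l]] that by (simp add: basis_vector_def)
  ultimately show ?thesis
    unfolding inverse_matrices_def by (intro exI[of _ ?B]) blast
qed

lemma matrix_vector_closed:
  assumes "\<And>i j. i < n \<Longrightarrow> j < m \<Longrightarrow> A i j \<in> carrier R" and "x \<in> {..<m} \<rightarrow>\<^sub>E carrier R"
  shows "matrix_vector R m n A x \<in> {..<n} \<rightarrow>\<^sub>E carrier R"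
proof -
  have "(\<Oplus>j\<in>{..<m}. A i j \<otimes> x j) \<in> carrier R" if "i < n" for i
    using assms that by (intro finsum_closed) auto
  then show ?thesis by (simp add: matrix_vector_def)
qed

lemma matrix_vector_inverse:
  assumes AB: "inverse_matrices R m n A B" and x: "x \<in> {..<m} \<rightarrow>\<^sub>E carrier R"
  shows "matrix_vector R n m B (matrix_vector R m n A x) = x"
proof (rule ext)
  fix l
  have A: "A i j \<in> carrier R" and B: "B j i \<in> carrier R" if "i < n" "j < m" for i j
    using AB that unfolding inverse_matrices_def by blast+
  have xc: "x j \<in> carrier R" if "j < m" for j
    using x that by auto
  have row: "(\<Oplus>j\<in>{..<m}. A i j \<otimes> x j) \<in> carrier R" if "i < n" for i
    using A xc that by (intro finsum_closed) auto
  show "matrix_vector R n m B (matrix_vector R m n A x) l = x l"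
  proof (cases "l < m")
    case True
    have "matrix_vector R n m B (matrix_vector R m n A x) l
        = (\<Oplus>i\<in>{..<n}. B l i \<otimes> (\<Oplus>j\<in>{..<m}. A i j \<otimes> x j))"
      using True B row by (simp add: matrix_vector_def) (intro finsum_cong'; simp)
    also have "\<dots> = (\<Oplus>i\<in>{..<n}. \<Oplus>j\<in>{..<m}. B l i \<otimes> A i j \<otimes> x j)"
      using True A B xc
      by (intro finsum_cong') (auto simp: finsum_rdistr m_assoc Pi_def intro!: finsum_cong' finsum_closed)
    also have "\<dots> = (\<Oplus>j\<in>{..<m}. \<Oplus>i\<in>{..<n}. B l i \<otimes> A i j \<otimes> x j)"
      using True A B xc by (intro finsum_swap) auto
    also have "\<dots> = (\<Oplus>j\<in>{..<m}. (\<Oplus>i\<in>{..<n}. B l i \<otimes> A i j) \<otimes> x j)"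
      using True A B xc by (intro finsum_cong') (auto simp: finsum_ldistr Pi_def intro!: finsum_closed)
    also have "\<dots> = (\<Oplus>j\<in>{..<m}. (if l = j then \<one> else \<zero>) \<otimes> x j)"
      using AB True xc by (intro finsum_cong') (simp_all add: inverse_matrices_def)
    also have "\<dots> = x l"
      using True xc by (intro finsum_delta_mult) auto
    finally show ?thesis .
  next
    case False
    then show ?thesis using x by (auto simp: matrix_vector_def PiE_def extensional_def)
  qed
qed

text \<open>
  Conversely, a pair of inverse matrices gives an isomorphism. So a ring has IBN exactly when
  inverse matrices over it are square, and in this form the property is visibly inherited along
  unital homomorphisms.
\<close>

lemma inverse_matrices_imp_right_module_iso:
  assumes AB: "inverse_matrices R m n A B"
  shows "matrix_vector R m n A \<in> right_module_iso R (free_right_module R m) (free_right_module R n)"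
proof -
  have A: "A i j \<in> carrier R" and B: "B j i \<in> carrier R" if "i < n" "j < m" for i j
    using AB that unfolding inverse_matrices_def by blast+
  have "bij_betw (matrix_vector R m n A) ({..<m} \<rightarrow>\<^sub>E carrier R) ({..<n} \<rightarrow>\<^sub>E carrier R)"
  proof (rule bij_betw_byWitness[where f' = "matrix_vector R n m B"])
    show "\<forall>x\<in>{..<m} \<rightarrow>\<^sub>E carrier R. matrix_vector R n m B (matrix_vector R m n A x) = x"
      using matrix_vector_inverse[OF AB] by blast
    show "\<forall>y\<in>{..<n} \<rightarrow>\<^sub>E carrier R. matrix_vector R m n A (matrix_vector R n m B y) = y"
      using matrix_vector_inverse[OF inverse_matrices_sym[OF AB]] by blast
    show "matrix_vector R m n A ` ({..<m} \<rightarrow>\<^sub>E carrier R) \<subseteq> {..<n} \<rightarrow>\<^sub>E carrier R"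
      using A by (intro image_subsetI matrix_vector_closed) auto
    show "matrix_vector R n m B ` ({..<n} \<rightarrow>\<^sub>E carrier R) \<subseteq> {..<m} \<rightarrow>\<^sub>E carrier R"
      using B by (intro image_subsetI matrix_vector_closed) auto
  qed
  moreover have "matrix_vector R m n A (\<lambda>i\<in>{..<m}. x i \<oplus> y i)
      = (\<lambda>i\<in>{..<n}. matrix_vector R m n A x i \<oplus> matrix_vector R m n A y i)"
    if "x \<in> {..<m} \<rightarrow>\<^sub>E carrier R" "y \<in> {..<m} \<rightarrow>\<^sub>E carrier R" for x y
  proof (rule ext)
    fix i
    have xy: "x j \<in> carrier R" "y j \<in> carrier R" if "j < m" for j
      using \<open>x \<in> _\<close> \<open>y \<in> _\<close> that by auto
    have "(\<Oplus>j\<in>{..<m}. A i j \<otimes> (\<lambda>j\<in>{..<m}. x j \<oplus> y j) j)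
        = (\<Oplus>j\<in>{..<m}. A i j \<otimes> x j) \<oplus> (\<Oplus>j\<in>{..<m}. A i j \<otimes> y j)"
      if "i < n"
    proof -
      have "(\<Oplus>j\<in>{..<m}. A i j \<otimes> (\<lambda>j\<in>{..<m}. x j \<oplus> y j) j)
          = (\<Oplus>j\<in>{..<m}. A i j \<otimes> x j \<oplus> A i j \<otimes> y j)"
        using A xy that by (intro finsum_cong') (auto simp: r_distr)
      also have "\<dots> = (\<Oplus>j\<in>{..<m}. A i j \<otimes> x j) \<oplus> (\<Oplus>j\<in>{..<m}. A i j \<otimes> y j)"
        using A xy that by (intro finsum_addf) auto
      finally show ?thesis .
    qed
    then show "matrix_vector R m n A (\<lambda>i\<in>{..<m}. x i \<oplus> y i) i
      = (\<lambda>i\<in>{..<n}. matrix_vector R m n A x i \<oplus> matrix_vector R m n A y i) i"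
      using A xy by (auto simp: matrix_vector_def cong: finsum_cong')
  qed
  moreover have "matrix_vector R m n A (\<lambda>i\<in>{..<m}. x i \<otimes> r)
      = (\<lambda>i\<in>{..<n}. matrix_vector R m n A x i \<otimes> r)"
    if "x \<in> {..<m} \<rightarrow>\<^sub>E carrier R" "r \<in> carrier R" for x r
  proof (rule ext)
    fix i
    have xc: "x j \<in> carrier R" if "j < m" for j
      using \<open>x \<in> _\<close> that by auto
    have "(\<Oplus>j\<in>{..<m}. A i j \<otimes> (\<lambda>j\<in>{..<m}. x j \<otimes> r) j)
        = (\<Oplus>j\<in>{..<m}. A i j \<otimes> x j) \<otimes> r" if "i < n"
      using A xc that \<open>r \<in> carrier R\<close>
      by (subst finsum_ldistr) (auto simp: m_assoc intro!: finsum_cong')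
    then show "matrix_vector R m n A (\<lambda>i\<in>{..<m}. x i \<otimes> r) i
      = (\<lambda>i\<in>{..<n}. matrix_vector R m n A x i \<otimes> r) i"
      using A xc \<open>r \<in> carrier R\<close> by (auto simp: matrix_vector_def cong: finsum_cong')
  qed
  ultimately show ?thesis
    by (simp add: right_module_iso_def free_right_module_def)
qed

end

lemma (in ring_hom_ring) inverse_matrices_image:
  assumes AB: "inverse_matrices R m n A B"
  shows "inverse_matrices S m n (\<lambda>i j. h (A i j)) (\<lambda>j i. h (B j i))"
proof -
  have A: "A i j \<in> carrier R" and B: "B j i \<in> carrier R" if "i < n" "j < m" for i j
    using AB that unfolding inverse_matrices_def by blast+
  have "(\<Oplus>\<^bsub>S\<^esub>i\<in>{..<n}. h (B j i) \<otimes>\<^bsub>S\<^esub> h (A i k)) = h (\<Oplus>i\<in>{..<n}. B j i \<otimes> A i k)"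
    if "j < m" "k < m" for j k
    using A B that by (subst hom_finsum) (auto intro!: S.finsum_cong')
  moreover have "(\<Oplus>\<^bsub>S\<^esub>j\<in>{..<m}. h (A i j) \<otimes>\<^bsub>S\<^esub> h (B j k)) = h (\<Oplus>j\<in>{..<m}. A i j \<otimes> B j k)"
    if "i < n" "k < n" for i k
    using A B that by (subst hom_finsum) (auto intro!: S.finsum_cong')
  ultimately show ?thesis
    using AB by (simp add: inverse_matrices_def)
qed

text \<open>
  The entrywise image of a non-square pair of inverse matrices is again one, because a unital
  homomorphism preserves identity matrices. So a failure of IBN in the source is carried over to the
  target.
\<close>

theorem (in ring_hom_ring) IBN_pullback:
  assumes "IBN S"
  shows "IBN R"
  unfolding IBN_def
proof (intro allI impI)
  fix m n :: nat
  assume "0 < m" "0 < n"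
    and "right_module_iso R (free_right_module R m) (free_right_module R n) \<noteq> {}"
  then obtain A B where "inverse_matrices R m n A B"
    using R.right_module_iso_imp_inverse_matrices by blast
  from S.inverse_matrices_imp_right_module_iso[OF inverse_matrices_image[OF this]]
  show "m = n"
    using assms \<open>0 < m\<close> \<open>0 < n\<close> unfolding IBN_def by blast
qed

text \<open>
  The closure properties of the homogeneous components under which degrees in a matrix product
  add up.
\<close>

locale graded_ring = ring R for R (structure) +
  fixes C :: "int \<Rightarrow> 'a set"
  assumes comp_closed: "C d \<subseteq> carrier R"
    and zero_comp: "\<zero> \<in> C d"
    and one_comp: "\<one> \<in> C 0"
    and add_comp: "x \<in> C d \<Longrightarrow> y \<in> C d \<Longrightarrow> x \<oplus> y \<in> C d"
    and mult_comp: "x \<in> C d \<Longrightarrow> y \<in> C e \<Longrightarrow> x \<otimes> y \<in> C (d + e)"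
begin

lemma finsum_comp:
  assumes "finite I" and "\<And>i. i \<in> I \<Longrightarrow> f i \<in> C d"
  shows "(\<Oplus>i\<in>I. f i) \<in> C d"
  using assms
proof (induction I rule: finite_induct)
  case empty
  then show ?case by (simp add: zero_comp)
next
  case (insert a I)
  then have "f \<in> insert a I \<rightarrow> carrier R"
    using comp_closed by blast
  then show ?case using insert by (simp add: finsum_insert add_comp Pi_def)
qed

end

text \<open>
  The graded refinement rests on the degrees of the matrix entries. In the sum of the shifts
  \<open>R(\<alpha> j)\<close> the basis vector with index \<open>j\<close> is homogeneous of degree \<open>- \<alpha> j\<close>, so the matrix of a
  graded isomorphism has its entry in row \<open>i\<close> and column \<open>j\<close> in degree \<open>\<beta> i - \<alpha> j\<close>. A graded
  homomorphism preserves these degrees, and any matrix with such entries acts by a graded map.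
\<close>

theorem (in ring_hom_ring) gr_IBN_pullback:
  assumes "graded_ring R C" and "graded_ring S D"
    and hom: "\<And>d. h ` C d \<subseteq> D d" and "gr_IBN S D"
  shows "gr_IBN R C"
  unfolding gr_IBN_def
proof (intro allI impI)
  interpret C: graded_ring R C by fact
  interpret D: graded_ring S D by fact
  fix m n :: nat and \<alpha> \<beta> :: "nat \<Rightarrow> int"
  let ?C = "\<lambda>n \<alpha>. direct_sum_grading n (\<lambda>i. shift C (\<alpha> i))"
  let ?D = "\<lambda>n \<alpha>. direct_sum_grading n (\<lambda>i. shift D (\<alpha> i))"
  assume "0 < m" "0 < n"
    and "graded_right_module_iso R (free_right_module R m) (?C m \<alpha>)
      (free_right_module R n) (?C n \<beta>) \<noteq> {}"
  then obtain g where g: "g \<in> right_module_iso R (free_right_module R m) (free_right_module R n)"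
    and gr: "\<And>d. g ` ?C m \<alpha> d \<subseteq> ?C n \<beta> d"
    unfolding graded_right_module_iso_def by blast
  define A where "A = (\<lambda>i j. g (basis_vector R m j) i)"
  obtain B where AB: "inverse_matrices R m n A B"
    unfolding A_def using R.right_module_iso_imp_inverse_matrices[OF g] by blast
  have entry: "A i j \<in> C (\<beta> i - \<alpha> j)" if "i < n" "j < m" for i j
  proof -
    have "basis_vector R m j \<in> ?C m \<alpha> (- \<alpha> j)"
      by (auto simp: basis_vector_def direct_sum_grading_def shift_def C.zero_comp C.one_comp)
    then have "g (basis_vector R m j) \<in> ?C n \<beta> (- \<alpha> j)"
      using gr by blast
    then show ?thesis
      using that by (auto simp: A_def direct_sum_grading_def shift_def)
  qed
  let ?h = "matrix_vector S m n (\<lambda>i j. h (A i j))"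
  have "?h \<in> right_module_iso S (free_right_module S m) (free_right_module S n)"
    by (rule S.inverse_matrices_imp_right_module_iso[OF inverse_matrices_image[OF AB]])
  moreover have "?h x \<in> ?D n \<beta> d" if x: "x \<in> ?D m \<alpha> d" for x d
  proof -
    have "h (A i j) \<otimes>\<^bsub>S\<^esub> x j \<in> D (\<beta> i + d)" if "i < n" "j < m" for i j
    proof -
      have "h (A i j) \<in> D (\<beta> i - \<alpha> j)"
        using entry[OF that] hom by blast
      moreover have "x j \<in> D (\<alpha> j + d)"
        using x that by (auto simp: direct_sum_grading_def shift_def)
      ultimately have "h (A i j) \<otimes>\<^bsub>S\<^esub> x j \<in> D (\<beta> i - \<alpha> j + (\<alpha> j + d))"
        by (rule D.mult_comp)
      then show ?thesis by simp
    qed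
    then show ?thesis
      by (auto simp: matrix_vector_def direct_sum_grading_def shift_def intro!: D.finsum_comp)
  qed
  ultimately have "?h \<in> graded_right_module_iso S (free_right_module S m) (?D m \<alpha>)
      (free_right_module S n) (?D n \<beta>)"
    unfolding graded_right_module_iso_def by blast
  then show "m = n"
    using assms(4) \<open>0 < m\<close> \<open>0 < n\<close> unfolding gr_IBN_def by blast
qed

section \<open>The free algebra and its ideals\<close>

lemma poly_mapping_sum_monomials:
  fixes p :: "'a \<Rightarrow>\<^sub>0 'b::comm_monoid_add"
  shows
  "p = (\<Sum>w\<in>Poly_Mapping.keys p. Poly_Mapping.single w (Poly_Mapping.lookup p w))"
  by (rule poly_mapping_eqI)
    (simp add: lookup_sum lookup_single when_def in_keys_iff sum.delta' sum.delta)

lemma poly_mapping_monomial_induct [case_names monomial add]: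
  fixes p :: "'a \<Rightarrow>\<^sub>0 'b::comm_monoid_add"
  assumes "\<And>w c. P (Poly_Mapping.single w c)" and "\<And>p q. P p \<Longrightarrow> P q \<Longrightarrow> P (p + q)"
  shows "P p"
proof -
  have "P (\<Sum>w\<in>A. Poly_Mapping.single w (Poly_Mapping.lookup p w))" if "finite A" for A
    using that
  proof (induction A rule: finite_induct)
    case empty
    show ?case using assms(1)[of undefined 0] by simp
  next
    case (insert w A)
    then show ?case by (simp add: assms)
  qed
  then show ?thesis
    by (subst poly_mapping_sum_monomials) simp
qed

lemma free_scale_single [simp]:
  "free_scale c (Poly_Mapping.single w d) = Poly_Mapping.single w (c * d)"
  by (simp add: free_scale_def mult_single)

lemma free_scale_zero [simp]: "free_scale c 0 = 0" "free_scale 0 p = 0"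
  by (simp_all add: free_scale_def)

lemma free_scale_minus_one: "free_scale (- 1) p = - p"
  by (simp add: free_scale_def single_uminus)

lemma free_scale_one [simp]: "free_scale 1 p = p"
  by (simp add: free_scale_def)

lemma free_scale_add: "free_scale c (p + q) = free_scale c p + free_scale c q"
  by (simp add: free_scale_def distrib_left)

lemma free_scale_add_left: "free_scale (c + d) p = free_scale c p + free_scale d p"
  by (simp add: free_scale_def single_add distrib_right)

lemma free_scale_scale: "free_scale c (free_scale d p) = free_scale (c * d) p"
  by (simp add: free_scale_def mult_single flip: mult.assoc)

lemma free_scale_mult_left: "free_scale c p * q = free_scale c (p * q)"
  by (simp add: free_scale_def mult.assoc)

text \<open>Scalars are the multiples of the empty word, which commutes with every monomial.\<close>

lemma free_scale_mult_right: "p * free_scale c q = free_scale c (p * q)"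
proof -
  have "p * Poly_Mapping.single 0 c = Poly_Mapping.single 0 c * p"
    by (induction p rule: poly_mapping_monomial_induct)
      (simp_all add: mult_single distrib_left distrib_right mult.commute)
  then show ?thesis
    by (simp add: free_scale_def flip: mult.assoc)
qed

lemma keys_free_scale: "Poly_Mapping.keys (free_scale c p) \<subseteq> Poly_Mapping.keys p"
  using keys_mult[of "Poly_Mapping.single 0 c" p] by (auto simp: free_scale_def split: if_splits)

lemma letters_zero [simp]: "letters 0 = []"
  by (simp add: zero_fword_def)

lemma letters_plus [simp]: "letters (u + w) = letters u @ letters w"
  by (simp add: plus_fword_def)

lemma letters_eq_Nil_iff: "letters w = [] \<longleftrightarrow> w = 0"
  by (cases w) (simp add: zero_fword_def)

lemma free_algebra_zero [simp]: "0 \<in> free_algebra X"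
  by (simp add: free_algebra_def)

lemma free_algebra_add: "p \<in> free_algebra X \<Longrightarrow> q \<in> free_algebra X \<Longrightarrow> p + q \<in> free_algebra X"
  using keys_add[of p q] by (fastforce simp: free_algebra_def)

lemma free_algebra_scale: "p \<in> free_algebra X \<Longrightarrow> free_scale c p \<in> free_algebra X"
  using keys_free_scale[of c p] by (fastforce simp: free_algebra_def)

lemma free_algebra_uminus: "p \<in> free_algebra X \<Longrightarrow> - p \<in> free_algebra X"
  using free_algebra_scale[of p X "- 1"] by (simp add: free_scale_minus_one)

lemma free_algebra_mult:
  assumes "p \<in> free_algebra X" and "q \<in> free_algebra X"
  shows "p * q \<in> free_algebra X"
proof -
  have "w \<noteq> 0 \<and> set (letters w) \<subseteq> X" if w: "w \<in> Poly_Mapping.keys (p * q)" for w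
  proof -
    obtain a b where "w = a + b" "a \<in> Poly_Mapping.keys p" "b \<in> Poly_Mapping.keys q"
      using subsetD[OF keys_mult w] by blast
    then show ?thesis
      using assms by (auto simp: free_algebra_def simp flip: letters_eq_Nil_iff)
  qed
  then show ?thesis by (simp add: free_algebra_def)
qed

lemma free_algebra_gen: "x \<in> X \<Longrightarrow> free_gen x \<in> free_algebra X"
  by (simp add: free_algebra_def free_gen_def zero_fword_def)

lemma free_algebra_sum: "(\<And>i. i \<in> I \<Longrightarrow> f i \<in> free_algebra X) \<Longrightarrow> sum f I \<in> free_algebra X"
  by (induction I rule: infinite_finite_induct) (auto intro: free_algebra_add)

text \<open>
  Words in the non-unital free algebra are nonempty, so the generators alone, without a unit, reach
  every element. This is what lets identities modulo an ideal be checked on generators.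
\<close>

lemma free_algebra_induct [consumes 1, case_names gen zero add scale mult]:
  fixes p :: "'x fword \<Rightarrow>\<^sub>0 'k::field"
  assumes p: "p \<in> free_algebra X"
    and gen: "\<And>x. x \<in> X \<Longrightarrow> P (free_gen x)"
    and zero: "P 0"
    and add: "\<And>p q. P p \<Longrightarrow> P q \<Longrightarrow> P (p + q)"
    and scale: "\<And>c p. P p \<Longrightarrow> P (free_scale c p)"
    and mult: "\<And>p q. p \<in> free_algebra X \<Longrightarrow> q \<in> free_algebra X \<Longrightarrow> P p \<Longrightarrow> P q \<Longrightarrow> P (p * q)"
  shows "P p"
proof -
  have monomial: "Poly_Mapping.single (FWord xs) (1::'k) \<in> free_algebra X
      \<and> P (Poly_Mapping.single (FWord xs) 1)"
    if "xs \<noteq> []" "set xs \<subseteq> X" for xs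
    using that
  proof (induction xs rule: list_nonempty_induct)
    case (single x)
    then show ?case
      using gen[of x] by (simp add: free_algebra_gen flip: free_gen_def)
  next
    case (cons x xs)
    have "Poly_Mapping.single (FWord (x # xs)) 1 = free_gen x * Poly_Mapping.single (FWord xs) (1::'k)"
      by (simp add: free_gen_def mult_single plus_fword_def)
    then show ?case
      using cons gen[of x] by (simp add: mult free_algebra_mult free_algebra_gen)
  qed
  have summand: "P (Poly_Mapping.single w (Poly_Mapping.lookup p w))" if "w \<in> Poly_Mapping.keys p" for w
  proof -
    have "letters w \<noteq> []" "set (letters w) \<subseteq> X"
      using p that by (auto simp: free_algebra_def letters_eq_Nil_iff)
    then have "P (free_scale (Poly_Mapping.lookup p w) (Poly_Mapping.single (FWord (letters w)) 1))"
      using monomial scale by blast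
    then show ?thesis by simp
  qed
  have "P (\<Sum>w\<in>A. Poly_Mapping.single w (Poly_Mapping.lookup p w))"
    if "finite A" "A \<subseteq> Poly_Mapping.keys p" for A
    using that by (induction A rule: finite_induct) (auto intro: zero add summand)
  then show ?thesis
    by (subst poly_mapping_sum_monomials) simp
qed

lemma algebra_ideal_uminus: "p \<in> algebra_ideal X S \<Longrightarrow> - p \<in> algebra_ideal X S"
  using algebra_ideal.scale[of p X S "- 1"] by (simp add: free_scale_minus_one)

lemma algebra_ideal_diff:
  "p \<in> algebra_ideal X S \<Longrightarrow> q \<in> algebra_ideal X S \<Longrightarrow> p - q \<in> algebra_ideal X S"
  using algebra_ideal.add[of p X S "- q"] by (simp add: algebra_ideal_uminus)

lemma algebra_ideal_sum:
  "(\<And>i. i \<in> I \<Longrightarrow> f i \<in> algebra_ideal X S) \<Longrightarrow> sum f I \<in> algebra_ideal X S"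
  by (induction I rule: infinite_finite_induct)
    (auto intro: algebra_ideal.add algebra_ideal.zero)

lemma equiv_algebra_cong: "equiv (free_algebra X) (algebra_cong X S)"
proof (rule equivI)
  show "algebra_cong X S \<subseteq> free_algebra X \<times> free_algebra X"
    by (auto simp: algebra_cong_def)
  show "refl_on (free_algebra X) (algebra_cong X S)"
    by (auto simp: refl_on_def algebra_cong_def algebra_ideal.zero)
  show "sym (algebra_cong X S)"
    by (auto simp: sym_def algebra_cong_def dest: algebra_ideal_uminus)
  show "trans (algebra_cong X S)"
    by (auto simp: trans_def algebra_cong_def dest: algebra_ideal.add)
qed

lemma algebra_cong_add:
  assumes "(p, p') \<in> algebra_cong X S" and "(q, q') \<in> algebra_cong X S"
  shows "(p + q, p' + q') \<in> algebra_cong X S"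
proof -
  have "p + q - (p' + q') = (p - p') + (q - q')" by simp
  moreover have "(p - p') + (q - q') \<in> algebra_ideal X S"
    using assms by (intro algebra_ideal.add) (auto simp: algebra_cong_def)
  ultimately have "p + q - (p' + q') \<in> algebra_ideal X S"
    by (simp only:)
  then show ?thesis
    using assms by (auto simp: algebra_cong_def intro: free_algebra_add)
qed

text \<open>
  The factors of \<open>(p - p') * q + p' * (q - q')\<close> outside the ideal lie in the non-unital free
  algebra, which is all the ideal can be multiplied by.
\<close>

lemma algebra_cong_mult:
  assumes "(p, p') \<in> algebra_cong X S" and "(q, q') \<in> algebra_cong X S"
  shows "(p * q, p' * q') \<in> algebra_cong X S"
proof -
  have "p * q - p' * q' = (p - p') * q + p' * (q - q')"
    by (simp add: algebra_simps)
  with assms show ?thesis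
    by (auto simp: algebra_cong_def free_algebra_mult 
        intro: algebra_ideal.add algebra_ideal.mult_left algebra_ideal.mult_right)
qed

section \<open>The universal property of the free algebra\<close>

definition word_eval :: "('x \<Rightarrow> ('y fword \<Rightarrow>\<^sub>0 'k::field)) \<Rightarrow> 'x fword \<Rightarrow> ('y fword \<Rightarrow>\<^sub>0 'k)" where
  "word_eval \<theta> w = prod_list (map \<theta> (letters w))"

text \<open>
  The algebra homomorphism that extends an assignment of the generators.
\<close>

definition free_lift ::
  "('x \<Rightarrow> ('y fword \<Rightarrow>\<^sub>0 'k::field)) \<Rightarrow> ('x fword \<Rightarrow>\<^sub>0 'k) \<Rightarrow> ('y fword \<Rightarrow>\<^sub>0 'k)"
where
  "free_lift \<theta> p =
    (\<Sum>w\<in>Poly_Mapping.keys p. free_scale (Poly_Mapping.lookup p w) (word_eval \<theta> w))"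

lemma free_lift_single: "free_lift \<theta> (Poly_Mapping.single w c) = free_scale c (word_eval \<theta> w)"
  by (simp add: free_lift_def)

lemma free_lift_gen [simp]: "free_lift \<theta> (free_gen x) = \<theta> x"
  by (simp add: free_gen_def free_lift_single word_eval_def)

lemma free_lift_zero [simp]: "free_lift \<theta> 0 = 0"
  by (simp add: free_lift_def)

lemma free_lift_add: "free_lift \<theta> (p + q) = free_lift \<theta> p + free_lift \<theta> q"
  unfolding free_lift_def by (rule setsum_keys_plus_distrib) (simp_all add: free_scale_add_left)

lemma free_lift_sum: "free_lift \<theta> (sum f I) = (\<Sum>i\<in>I. free_lift \<theta> (f i))"
  by (induction I rule: infinite_finite_induct) (simp_all add: free_lift_add)

lemma free_lift_scale: "free_lift \<theta> (free_scale c p) = free_scale c (free_lift \<theta> p)"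
  by (induction p rule: poly_mapping_monomial_induct)
    (simp_all add: free_lift_single free_lift_add free_scale_add free_scale_scale)

lemma free_lift_uminus: "free_lift \<theta> (- p) = - free_lift \<theta> p"
  using free_lift_scale[of \<theta> "- 1" p] by (simp add: free_scale_minus_one)

lemma free_lift_diff: "free_lift \<theta> (p - q) = free_lift \<theta> p - free_lift \<theta> q"
  using free_lift_add[of \<theta> p "- q"] by (simp add: free_lift_uminus)

lemma free_lift_mult: "free_lift \<theta> (p * q) = free_lift \<theta> p * free_lift \<theta> q"
proof (induction p rule: poly_mapping_monomial_induct)
  case (monomial u c)
  show ?case
  proof (induction q rule: poly_mapping_monomial_induct)
    case (monomial w d)
    show ?case
      by (simp add: mult_single free_lift_single word_eval_def free_scale_mult_left
          free_scale_mult_right free_scale_scale mult.commute)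
  next
    case (add p q)
    then show ?case by (simp add: distrib_left free_lift_add)
  qed
next
  case (add p q)
  then show ?case by (simp add: distrib_right free_lift_add)
qed

lemma free_lift_in_free_algebra:
  assumes \<theta>: "\<And>x. x \<in> X \<Longrightarrow> \<theta> x \<in> free_algebra Y" and p: "p \<in> free_algebra X"
  shows "free_lift \<theta> p \<in> free_algebra Y"
proof -
  have prod: "prod_list (map \<theta> xs) \<in> free_algebra Y" if "xs \<noteq> []" "set xs \<subseteq> X" for xs
    using that by (induction xs rule: list_nonempty_induct) (auto intro: free_algebra_mult \<theta>)
  have "word_eval \<theta> w \<in> free_algebra Y" if "w \<in> Poly_Mapping.keys p" for w
    unfolding word_eval_def using p that
    by (intro prod) (auto simp: free_algebra_def letters_eq_Nil_iff)
  then show ?thesis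
    unfolding free_lift_def by (intro free_algebra_sum free_algebra_scale)
qed

text \<open>
  An assignment that respects the relations induces a homomorphism between the presented algebras.
\<close>

lemma free_lift_in_algebra_ideal:
  assumes \<theta>: "\<And>x. x \<in> X \<Longrightarrow> \<theta> x \<in> free_algebra Y"
    and rel: "\<And>r. r \<in> S \<Longrightarrow> free_lift \<theta> r \<in> algebra_ideal Y T"
    and p: "p \<in> algebra_ideal X S"
  shows "free_lift \<theta> p \<in> algebra_ideal Y T"
  using p
proof (induction p rule: algebra_ideal.induct)
  case (base p) then show ?case by (rule rel)
next
  case zero then show ?case by (simp add: algebra_ideal.zero)
next
  case (add p q) then show ?case by (simp add: free_lift_add algebra_ideal.add)
next
  case (scale p c) then show ?case by (simp add: free_lift_scale algebra_ideal.scale)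
next
  case (mult_left a p)
  then show ?case
    by (simp add: free_lift_mult algebra_ideal.mult_left free_lift_in_free_algebra[OF \<theta>])
next
  case (mult_right p a)
  then show ?case
    by (simp add: free_lift_mult algebra_ideal.mult_right free_lift_in_free_algebra[OF \<theta>])
qed

section \<open>The ring structure of a Leavitt path algebra\<close>

abbreviation lpa_ideal :: "('v, 'e) pre_digraph \<Rightarrow> ('v, 'e, 'k::field) lpa_free set" where
  "lpa_ideal E \<equiv> algebra_ideal (lpa_gens E) (lpa_relations E)"

definition vertex_sum :: "('v, 'e) pre_digraph \<Rightarrow> ('v, 'e, 'k::field) lpa_free" where
  "vertex_sum E = (\<Sum>v\<in>verts E. lpa_v v)"

lemma lpa_carrier:
  "carrier (leavitt_path_algebra TYPE('k::field) E) = lpa_class E ` free_algebra (lpa_gens E)"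
  by (auto simp: leavitt_path_algebra_def quotient_def)

lemma equiv_lpa_cong: "equiv (free_algebra (lpa_gens E)) (lpa_cong E)"
  unfolding lpa_cong_def by (rule equiv_algebra_cong)

lemma lpa_class_eq_iff:
  assumes "p \<in> free_algebra (lpa_gens E)" and "q \<in> free_algebra (lpa_gens E)"
  shows "lpa_class E p = lpa_class E q \<longleftrightarrow> p - q \<in> lpa_ideal E"
  using eq_equiv_class_iff[OF equiv_algebra_cong assms] assms
  by (auto simp: lpa_cong_def algebra_cong_def)

lemma lpa_add_class:
  assumes "p \<in> free_algebra (lpa_gens E)" and "q \<in> free_algebra (lpa_gens E)"
  shows "lpa_class E p \<oplus>\<^bsub>leavitt_path_algebra TYPE('k::field) E\<^esub> lpa_class E q = lpa_class E (p + q)"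
proof -
  have "congruent2 (lpa_cong E) (lpa_cong E) (\<lambda>p q. lpa_class E (p + q))"
    unfolding congruent2_def lpa_cong_def
    using algebra_cong_add equiv_class_eq[OF equiv_algebra_cong] by fast
  from UN_equiv_class2[OF equiv_lpa_cong equiv_lpa_cong this assms] show ?thesis
    by (simp add: leavitt_path_algebra_def)
qed

lemma lpa_mult_class:
  assumes "p \<in> free_algebra (lpa_gens E)" and "q \<in> free_algebra (lpa_gens E)"
  shows "lpa_class E p \<otimes>\<^bsub>leavitt_path_algebra TYPE('k::field) E\<^esub> lpa_class E q = lpa_class E (p * q)"
proof -
  have "congruent2 (lpa_cong E) (lpa_cong E) (\<lambda>p q. lpa_class E (p * q))"
    unfolding congruent2_def lpa_cong_def
    using algebra_cong_mult equiv_class_eq[OF equiv_algebra_cong] by fast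
  from UN_equiv_class2[OF equiv_lpa_cong equiv_lpa_cong this assms] show ?thesis
    by (simp add: leavitt_path_algebra_def)
qed

lemma lpa_zero: "\<zero>\<^bsub>leavitt_path_algebra TYPE('k::field) E\<^esub> = lpa_class E 0"
  by (simp add: leavitt_path_algebra_def)

lemma lpa_one: "\<one>\<^bsub>leavitt_path_algebra TYPE('k::field) E\<^esub> = lpa_class E (vertex_sum E)"
  by (simp add: leavitt_path_algebra_def vertex_sum_def)

lemma vertex_sum_in_free_algebra: "vertex_sum E \<in> free_algebra (lpa_gens E)"
  by (auto simp: vertex_sum_def lpa_gens_def intro!: free_algebra_sum free_algebra_gen)

context fin_digraph
begin

lemma vertex_sum_mult_vertex:
  assumes "w \<in> verts G"
  shows "vertex_sum G * lpa_v w - lpa_v w \<in> (lpa_ideal G :: ('a, 'b, 'k::field) lpa_free set)"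
    and "lpa_v w * vertex_sum G - lpa_v w \<in> (lpa_ideal G :: ('a, 'b, 'k::field) lpa_free set)"
proof -
  have "vertex_sum G * lpa_v w - lpa_v w
      = (\<Sum>v\<in>verts G. lpa_v v * lpa_v w - (if v = w then lpa_v w else (0 :: ('a, 'b, 'k) lpa_free)))"
    using assms by (simp add: vertex_sum_def sum_distrib_right sum_subtractf)
  also have "\<dots> \<in> lpa_ideal G"
    using assms by (intro algebra_ideal_sum algebra_ideal.base lpa_relations.vertex)
  finally show "vertex_sum G * lpa_v w - lpa_v w \<in> (lpa_ideal G :: ('a, 'b, 'k) lpa_free set)" .
  have "lpa_v w * vertex_sum G - lpa_v w
      = (\<Sum>v\<in>verts G. lpa_v w * lpa_v v - (if w = v then lpa_v v else (0 :: ('a, 'b, 'k) lpa_free)))"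
    using assms by (simp add: vertex_sum_def sum_distrib_left sum_subtractf)
  also have "\<dots> \<in> lpa_ideal G"
    using assms by (intro algebra_ideal_sum algebra_ideal.base lpa_relations.vertex)
  finally show "lpa_v w * vertex_sum G - lpa_v w \<in> (lpa_ideal G :: ('a, 'b, 'k) lpa_free set)" .
qed

text \<open>
  If one vertex is a local unit for \<open>p\<close> on one side, so is the sum \<open>u\<close> of all vertices. Modulo the
  ideal, \<open>u p = u (v p) = (u v) p = v p = p\<close>, and symmetrically on the right.
\<close>

lemma vertex_sum_absorb:
  assumes v: "v \<in> verts G" and p: "p \<in> free_algebra (lpa_gens G)"
  shows "lpa_v v * p - p \<in> lpa_ideal G \<Longrightarrow> vertex_sum G * p - p \<in> lpa_ideal G"
    and "p * lpa_v v - p \<in> lpa_ideal G \<Longrightarrow> p * vertex_sum G - p \<in> lpa_ideal G"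
proof -
  let ?u = "vertex_sum G"
  assume *: "lpa_v v * p - p \<in> lpa_ideal G"
  have "(?u * lpa_v v - lpa_v v) * p \<in> lpa_ideal G"
    by (rule algebra_ideal.mult_right[OF vertex_sum_mult_vertex(1)[OF v] p])
  moreover have "?u * (lpa_v v * p - p) \<in> lpa_ideal G"
    by (rule algebra_ideal.mult_left[OF vertex_sum_in_free_algebra *])
  moreover have "?u * p - p = (?u * lpa_v v - lpa_v v) * p - ?u * (lpa_v v * p - p) + (lpa_v v * p - p)"
    by (simp add: algebra_simps)
  ultimately show "?u * p - p \<in> lpa_ideal G"
    using * algebra_ideal.add algebra_ideal_diff by metis
next
  let ?u = "vertex_sum G"
  assume *: "p * lpa_v v - p \<in> lpa_ideal G"
  have "p * (lpa_v v * ?u - lpa_v v) \<in> lpa_ideal G"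
    by (rule algebra_ideal.mult_left[OF p vertex_sum_mult_vertex(2)[OF v]])
  moreover have "(p * lpa_v v - p) * ?u \<in> lpa_ideal G"
    by (rule algebra_ideal.mult_right[OF * vertex_sum_in_free_algebra])
  moreover have "p * ?u - p = p * (lpa_v v * ?u - lpa_v v) - (p * lpa_v v - p) * ?u + (p * lpa_v v - p)"
    by (simp add: algebra_simps)
  ultimately show "p * ?u - p \<in> lpa_ideal G"
    using * algebra_ideal.add algebra_ideal_diff by metis
qed

text \<open>
  For an edge or a ghost edge the local units are its end points, by the edge relations. On
  products the left unit property is inherited from the left factor and the right one from the
  right factor.
\<close>

lemma vertex_sum_unit:
  assumes "p \<in> free_algebra (lpa_gens G)"
  shows "vertex_sum G * p - p \<in> lpa_ideal G" and "p * vertex_sum G - p \<in> lpa_ideal G"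
proof -
  let ?u = "vertex_sum G"
  have "?u * p - p \<in> lpa_ideal G \<and> p * ?u - p \<in> lpa_ideal G"
    using assms
  proof (induction p rule: free_algebra_induct)
    case (gen x)
    then have x: "free_gen x \<in> free_algebra (lpa_gens G)"
      by (rule free_algebra_gen)
    show ?case
    proof (cases x)
      case (Vertex v)
      then show ?thesis
        using gen vertex_sum_mult_vertex by (auto simp: lpa_gens_def)
    next
      case (Edge e)
      then have e: "e \<in> arcs G" using gen by (auto simp: lpa_gens_def)
      show ?thesis
        unfolding Edge
        using e vertex_sum_absorb(1)[OF tail_in_verts[OF e] x] vertex_sum_absorb(2)[OF head_in_verts[OF e] x]
        by (simp add: Edge algebra_ideal.base lpa_relations.edge_tail lpa_relations.edge_head)
    next
      case (Ghost e)
      then have e: "e \<in> arcs G" using gen by (auto simp: lpa_gens_def)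
      show ?thesis
        unfolding Ghost
        using e vertex_sum_absorb(1)[OF head_in_verts[OF e] x] vertex_sum_absorb(2)[OF tail_in_verts[OF e] x]
        by (simp add: Ghost algebra_ideal.base lpa_relations.ghost_tail lpa_relations.ghost_head)
    qed
  next
    case zero
    then show ?case by (simp add: algebra_ideal.zero)
  next
    case (add p q)
    have "?u * (p + q) - (p + q) = (?u * p - p) + (?u * q - q)"
      and "(p + q) * ?u - (p + q) = (p * ?u - p) + (q * ?u - q)"
      by (simp_all add: algebra_simps)
    then show ?case using add algebra_ideal.add by metis
  next
    case (scale c p)
    have "?u * free_scale c p - free_scale c p = free_scale c (?u * p - p)"
      and "free_scale c p * ?u - free_scale c p = free_scale c (p * ?u - p)"
      by (simp_all add: free_scale_mult_left free_scale_mult_right)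
        (simp_all add: free_scale_def algebra_simps)
    then show ?case using scale by (simp add: algebra_ideal.scale)
  next
    case (mult p q)
    have "?u * (p * q) - p * q = (?u * p - p) * q" and "p * q * ?u - p * q = p * (q * ?u - q)"
      by (simp_all add: algebra_simps)
    then show ?case using mult by (simp add: algebra_ideal.mult_left algebra_ideal.mult_right)
  qed
  then show "?u * p - p \<in> lpa_ideal G" and "p * ?u - p \<in> lpa_ideal G"
    by simp_all
qed

theorem ring_leavitt_path_algebra: "ring (leavitt_path_algebra TYPE('k::field) G)"
proof -
  let ?R = "leavitt_path_algebra TYPE('k) G" and ?A = "free_algebra (lpa_gens G) :: ('a, 'b, 'k) lpa_free set"
  note ops = lpa_carrier lpa_add_class lpa_mult_class lpa_zero lpa_one free_algebra_add
    free_algebra_mult free_algebra_zero vertex_sum_in_free_algebra lpa_class_eq_iff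
  have inv: "\<exists>q\<in>?A. lpa_class G q \<oplus>\<^bsub>?R\<^esub> lpa_class G p = \<zero>\<^bsub>?R\<^esub>" if "p \<in> ?A" for p
    using that free_algebra_uminus[OF that]
    by (intro bexI[of _ "- p"]) (simp_all add: ops algebra_ideal.zero)
  have unit: "lpa_class G (vertex_sum G * p) = lpa_class G p"
    "lpa_class G (p * vertex_sum G) = lpa_class G p" if "p \<in> ?A" for p
    using that vertex_sum_unit[OF that] by (simp_all add: ops)
  show ?thesis
    by (intro ringI abelian_groupI monoidI)
      (use inv unit in \<open>auto simp: ops algebra_simps algebra_ideal.zero del: equalityI\<close>)
qed

end

lemma lpa_CK1:
  "e \<in> arcs E \<Longrightarrow> lpa_g e * lpa_e e - lpa_v (head E e) \<in> lpa_ideal E"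
  "e \<in> arcs E \<Longrightarrow> f \<in> arcs E \<Longrightarrow> e \<noteq> f \<Longrightarrow> lpa_g e * lpa_e f \<in> lpa_ideal E"
  using algebra_ideal.base[OF lpa_relations.CK1[of e E e]] algebra_ideal.base[OF lpa_relations.CK1[of e E f]]
  by simp_all

section \<open>The grading of a Leavitt path algebra\<close>

definition homogeneous :: "('v, 'e) pre_digraph \<Rightarrow> int \<Rightarrow> ('v, 'e, 'k::field) lpa_free set" where
  "homogeneous E d =
    {p \<in> free_algebra (lpa_gens E). \<forall>w\<in>Poly_Mapping.keys p. word_degree w = d}"

lemma word_degree_plus: "word_degree (u + w) = word_degree u + word_degree w"
  by (simp add: word_degree_def)

lemma lpa_component_eq: "lpa_component TYPE('k::field) E d = lpa_class E ` homogeneous E d"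
  by (simp add: lpa_component_def homogeneous_def)

lemma homogeneous_zero: "0 \<in> homogeneous E d"
  by (simp add: homogeneous_def)

lemma homogeneous_gen: "x \<in> lpa_gens E \<Longrightarrow> free_gen x \<in> homogeneous E (gen_degree x)"
  using free_algebra_gen[of x "lpa_gens E"]
  by (simp add: homogeneous_def free_gen_def word_degree_def)

lemma homogeneous_generators:
  "v \<in> verts E \<Longrightarrow> lpa_v v \<in> homogeneous E 0"
  "e \<in> arcs E \<Longrightarrow> lpa_e e \<in> homogeneous E 1"
  "e \<in> arcs E \<Longrightarrow> lpa_g e \<in> homogeneous E (- 1)"
  using homogeneous_gen[of "Vertex v" E] homogeneous_gen[of "Edge e" E] homogeneous_gen[of "Ghost e" E]
  by (simp_all add: lpa_gens_def)

lemma homogeneous_add: "p \<in> homogeneous E d \<Longrightarrow> q \<in> homogeneous E d \<Longrightarrow> p + q \<in> homogeneous E d"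
  using keys_add[of p q] by (auto simp: homogeneous_def free_algebra_add)

lemma homogeneous_sum: "(\<And>i. i \<in> I \<Longrightarrow> f i \<in> homogeneous E d) \<Longrightarrow> sum f I \<in> homogeneous E d"
  by (induction I rule: infinite_finite_induct) (auto intro: homogeneous_add homogeneous_zero)

lemma homogeneous_scale: "p \<in> homogeneous E d \<Longrightarrow> free_scale c p \<in> homogeneous E d"
  using keys_free_scale[of c p] by (auto simp: homogeneous_def free_algebra_scale)

lemma homogeneous_mult:
  assumes "p \<in> homogeneous E c" and "q \<in> homogeneous E d"
  shows "p * q \<in> homogeneous E (c + d)"
proof -
  have "word_degree w = c + d" if w: "w \<in> Poly_Mapping.keys (p * q)" for w
  proof -
    obtain a b where "w = a + b" "a \<in> Poly_Mapping.keys p" "b \<in> Poly_Mapping.keys q"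
      using subsetD[OF keys_mult w] by blast
    then show ?thesis
      using assms by (auto simp: homogeneous_def word_degree_plus)
  qed
  then show ?thesis
    using assms by (simp add: homogeneous_def free_algebra_mult)
qed

theorem (in fin_digraph) graded_ring_leavitt_path_algebra:
  "graded_ring (leavitt_path_algebra TYPE('k::field) G) (lpa_component TYPE('k) G)"
proof -
  have sub: "p \<in> free_algebra (lpa_gens G)" if "p \<in> homogeneous G d" for p :: "('a, 'b, 'k) lpa_free" and d
    using that by (simp add: homogeneous_def)
  have one: "vertex_sum G \<in> (homogeneous G 0 :: ('a, 'b, 'k) lpa_free set)"
    unfolding vertex_sum_def by (intro homogeneous_sum homogeneous_generators)
  show ?thesis
    by (intro graded_ring.intro graded_ring_axioms.intro ring_leavitt_path_algebra)
      (auto simp: lpa_component_eq lpa_carrier lpa_zero lpa_one lpa_add_class lpa_mult_class sub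
        intro: one homogeneous_zero homogeneous_add homogeneous_mult)
qed

section \<open>Projection to the column over a source\<close>

text \<open>
  The column over \<open>w\<close> is the copy \<open>E \<times> {w}\<close> of \<open>E\<close> inside \<open>E \<times> F\<close>. Its vertices, edges and ghost
  edges go to those of \<open>E\<close>; every other generator is killed.
\<close>

fun column_gen ::
  "'w \<Rightarrow> ('v \<times> 'w, 'e \<times> 'w + 'v \<times> 'f) lpa_gen \<Rightarrow> ('v, 'e, 'k::field) lpa_free"
where
  "column_gen w (Vertex (v, x)) = (if x = w then lpa_v v else 0)"
| "column_gen w (Edge (Inl (e, x))) = (if x = w then lpa_e e else 0)"
| "column_gen w (Edge (Inr (v, f))) = 0"
| "column_gen w (Ghost (Inl (e, x))) = (if x = w then lpa_g e else 0)"
| "column_gen w (Ghost (Inr (v, f))) = 0"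

lemma cartesian_product_simps [simp]:
  "verts (cartesian_product E F) = verts E \<times> verts F"
  "arcs (cartesian_product E F) = (arcs E \<times> verts F) <+> (verts E \<times> arcs F)"
  "tail (cartesian_product E F) (Inl (e, x)) = (tail E e, x)"
  "tail (cartesian_product E F) (Inr (v, f)) = (v, tail F f)"
  "head (cartesian_product E F) (Inl (e, x)) = (head E e, x)"
  "head (cartesian_product E F) (Inr (v, f)) = (v, head F f)"
  by (simp_all add: cartesian_product_def)

lemma fin_digraph_cartesian_product:
  assumes "fin_digraph E" and "fin_digraph F"
  shows "fin_digraph (cartesian_product E F)"
proof -
  interpret E: fin_digraph E by fact
  interpret F: fin_digraph F by fact
  show ?thesis
    by unfold_locales auto
qed

lemma out_arcs_cartesian_product:
  "v \<in> verts E \<Longrightarrow> x \<in> verts F \<Longrightarrow>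
    out_arcs (cartesian_product E F) (v, x)
      = Inl ` (out_arcs E v \<times> {x}) \<union> Inr ` ({v} \<times> out_arcs F x)"
  by (auto simp: out_arcs_def)

text \<open>
  The last parameter only fixes the field of coefficients.
\<close>

locale column_projection =
  E: fin_digraph E + F: fin_digraph F
  for E :: "('v, 'e) pre_digraph" and F :: "('w, 'f) pre_digraph" +
  fixes w :: 'w and field_type :: "'k::field itself"
  assumes no_sink: "\<not> is_sink E v"
    and source: "is_source F w"
begin

abbreviation lift :: "('v \<times> 'w, 'e \<times> 'w + 'v \<times> 'f, 'k) lpa_free \<Rightarrow> ('v, 'e, 'k) lpa_free" where
  "lift \<equiv> free_lift (column_gen w)"

sublocale EF: fin_digraph "cartesian_product E F"
  by (rule fin_digraph_cartesian_product) unfold_locales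

lemma source_in_verts: "w \<in> verts F"
  using source by (simp add: is_source_def)

lemma head_neq_source: "f \<in> arcs F \<Longrightarrow> head F f \<noteq> w"
  using source by (auto simp: is_source_def in_arcs_def)

lemma regular: "v \<in> verts E \<Longrightarrow> is_regular E v"
  using no_sink[of v] by (auto simp: is_sink_def is_regular_def out_arcs_def)

lemma column_gen_homogeneous:
  assumes "x \<in> lpa_gens (cartesian_product E F)"
  shows "(column_gen w x :: ('v, 'e, 'k) lpa_free) \<in> homogeneous E (gen_degree x)"
  using assms by (auto simp: lpa_gens_def homogeneous_zero homogeneous_generators)

lemma column_gen_in_free_algebra:
  "x \<in> lpa_gens (cartesian_product E F) \<Longrightarrow>
    (column_gen w x :: ('v, 'e, 'k) lpa_free) \<in> free_algebra (lpa_gens E)"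
  using column_gen_homogeneous[of x] by (simp add: homogeneous_def)

lemma lift_in_free_algebra:
  "p \<in> free_algebra (lpa_gens (cartesian_product E F)) \<Longrightarrow> lift p \<in> free_algebra (lpa_gens E)"
  by (rule free_lift_in_free_algebra[OF column_gen_in_free_algebra])

text \<open>
  The summands over the edges of \<open>F\<close> vanish. What is left is the relation of \<open>E\<close> at \<open>v\<close> in the
  column over \<open>w\<close> and zero in all others.
\<close>

lemma lift_CK2:
  assumes v: "v \<in> verts E" and x: "x \<in> verts F"
  shows "lift (lpa_v (v, x) - (\<Sum>a\<in>out_arcs (cartesian_product E F) (v, x). lpa_e a * lpa_g a))
    = (if x = w then lpa_v v - (\<Sum>e\<in>out_arcs E v. lpa_e e * lpa_g e) else 0)"
proof -
  let ?f = "\<lambda>a :: 'e \<times> 'w + 'v \<times> 'f. column_gen w (Edge a) * (column_gen w (Ghost a) :: ('v, 'e, 'k) lpa_free)"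
  have fin: "finite (out_arcs E v)" "finite (out_arcs F x)"
    by (simp_all add: out_arcs_def)
  have "(\<Sum>a\<in>out_arcs (cartesian_product E F) (v, x). ?f a)
      = (\<Sum>a\<in>Inl ` (out_arcs E v \<times> {x}). ?f a) + (\<Sum>a\<in>Inr ` ({v} \<times> out_arcs F x). ?f a)"
    unfolding out_arcs_cartesian_product[OF v x]
    by (rule sum.union_disjoint) (use fin in auto)
  also have "(\<Sum>a\<in>Inr ` ({v} \<times> out_arcs F x). ?f a) = 0"
    by (rule sum.neutral) auto
  also have "(\<Sum>a\<in>Inl ` (out_arcs E v \<times> {x}). ?f a)
      = (\<Sum>e\<in>out_arcs E v. ?f (Inl (e, x)))"
    by (rule sum.reindex_cong[of "\<lambda>e. Inl (e, x)"]) (auto simp: inj_on_def)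
  finally show ?thesis
    by (simp add: free_lift_diff free_lift_sum free_lift_mult)
qed

text \<open>
  The hypotheses on \<open>E\<close> and \<open>F\<close> enter through the two Cuntz-Krieger relations. An edge
  \<open>f\<close> of \<open>F\<close> gives the relation that \<open>(v, f)\<^sup>*(v, f)\<close> equals \<open>(v, head f)\<close>, whose left side is killed;
  the right side is killed as well because \<open>head f\<close> is not the source \<open>w\<close>. The vertex \<open>(v, w)\<close> is
  sent to \<open>v\<close> while the edges leaving it along \<open>F\<close> are killed, so its relation turns
  into that of \<open>v\<close> in \<open>E\<close>, which is imposed there because \<open>v\<close> is not a sink.
\<close>

lemma lift_relation:
  assumes "r \<in> lpa_relations (cartesian_product E F)"
  shows "lift r \<in> lpa_ideal E"
  using assms
proof cases
  case (vertex v u)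
  obtain a x b y where vu: "v = (a, x)" "u = (b, y)" by (cases v; cases u)
  have "lpa_v a * lpa_v b - (if a = b then lpa_v b else 0) \<in> (lpa_ideal E :: ('v, 'e, 'k) lpa_free set)"
    using vertex by (intro algebra_ideal.base lpa_relations.vertex) (simp_all add: vu)
  then show ?thesis
    by (auto simp: vertex(1) vu free_lift_diff free_lift_mult algebra_ideal.zero split: if_splits)
next
  case (edge_tail a)
  then show ?thesis
    by (auto simp: free_lift_diff free_lift_mult algebra_ideal.zero
        algebra_ideal.base[OF lpa_relations.edge_tail])
next
  case (edge_head a)
  then show ?thesis
    by (auto simp: free_lift_diff free_lift_mult algebra_ideal.zero
        algebra_ideal.base[OF lpa_relations.edge_head])
next
  case (ghost_head a)
  then show ?thesis
    by (auto simp: free_lift_diff free_lift_mult algebra_ideal.zero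
        algebra_ideal.base[OF lpa_relations.ghost_head])
next
  case (ghost_tail a)
  then show ?thesis
    by (auto simp: free_lift_diff free_lift_mult algebra_ideal.zero
        algebra_ideal.base[OF lpa_relations.ghost_tail])
next
  case (CK1 a b)
  show ?thesis
  proof (cases "a = b")
    case True
    then show ?thesis
      using CK1 by (auto simp: free_lift_diff free_lift_mult algebra_ideal.zero head_neq_source
          lpa_CK1(1))
  next
    case False
    then have r: "r = lpa_g a * lpa_e b"
      using CK1 by simp
    show ?thesis
    proof (cases "\<exists>e f. a = Inl (e, w) \<and> b = Inl (f, w)")
      case True
      then obtain e f where ab: "a = Inl (e, w)" "b = Inl (f, w)"
        by blast
      then have "lpa_g e * lpa_e f \<in> (lpa_ideal E :: ('v, 'e, 'k) lpa_free set)"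
        using CK1(2,3) \<open>a \<noteq> b\<close> by (intro lpa_CK1(2)) auto
      then show ?thesis
        by (simp add: r ab free_lift_mult)
    next
      case False
      then have "column_gen w (Ghost a) = (0 :: ('v, 'e, 'k) lpa_free)
          \<or> column_gen w (Edge b) = (0 :: ('v, 'e, 'k) lpa_free)"
        by (cases a; cases b) auto
      then show ?thesis
        by (auto simp: r free_lift_mult algebra_ideal.zero)
    qed
  qed
next
  case (CK2 u)
  obtain v x where u: "u = (v, x)" by (cases u)
  with CK2 have "v \<in> verts E" "x \<in> verts F" by (auto simp: is_regular_def)
  then show ?thesis
    unfolding CK2(1) u lift_CK2[OF \<open>v \<in> verts E\<close> \<open>x \<in> verts F\<close>]
    by (auto intro: algebra_ideal.base algebra_ideal.zero lpa_relations.CK2 regular)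
qed

lemma lift_ideal: "p \<in> lpa_ideal (cartesian_product E F) \<Longrightarrow> lift p \<in> lpa_ideal E"
  by (rule free_lift_in_algebra_ideal[OF column_gen_in_free_algebra lift_relation])

lemma lift_vertex_sum: "lift (vertex_sum (cartesian_product E F)) = vertex_sum E"
proof -
  have "lift (vertex_sum (cartesian_product E F))
      = (\<Sum>v\<in>verts E. \<Sum>x\<in>verts F. if x = w then lpa_v v else 0)"
    by (simp add: vertex_sum_def free_lift_sum sum.cartesian_product')
  then show ?thesis
    by (simp add: vertex_sum_def source_in_verts)
qed

lemma lift_homogeneous:
  assumes p: "p \<in> homogeneous (cartesian_product E F) d"
  shows "lift p \<in> homogeneous E d"
proof -
  have prod: "prod_list (map (column_gen w) xs) \<in> (homogeneous E (\<Sum>x\<leftarrow>xs. gen_degree x) :: ('v, 'e, 'k) lpa_free set)"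
    if "xs \<noteq> []" "set xs \<subseteq> lpa_gens (cartesian_product E F)" for xs
    using that
    by (induction xs rule: list_nonempty_induct)
      (auto intro: homogeneous_mult column_gen_homogeneous)
  have "word_eval (column_gen w) u \<in> (homogeneous E d :: ('v, 'e, 'k) lpa_free set)"
    if "u \<in> Poly_Mapping.keys p" for u
    using prod[of "letters u"] p that
    by (auto simp: homogeneous_def free_algebra_def letters_eq_Nil_iff word_degree_def word_eval_def)
  then show ?thesis
    unfolding free_lift_def by (intro homogeneous_sum homogeneous_scale)
qed

text \<open>
  The induced map on residue classes, written as a union so that no representative is chosen.
\<close>

definition proj ::
  "('v \<times> 'w, 'e \<times> 'w + 'v \<times> 'f, 'k) lpa_free set \<Rightarrow> ('v, 'e, 'k) lpa_free set"
where
  "proj P = (\<Union>p\<in>P. lpa_class E (lift p))"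

lemma proj_class:
  assumes "p \<in> free_algebra (lpa_gens (cartesian_product E F))"
  shows "proj (lpa_class (cartesian_product E F) p) = lpa_class E (lift p)"
proof -
  have "lpa_class E (lift q) = lpa_class E (lift r)" if "(q, r) \<in> lpa_cong (cartesian_product E F)" for q r
  proof -
    have "lift q \<in> free_algebra (lpa_gens E)" "lift r \<in> free_algebra (lpa_gens E)" "lift q - lift r \<in> lpa_ideal E"
      using that lift_ideal[of "q - r"]
      by (auto simp: lpa_cong_def algebra_cong_def free_lift_diff intro: lift_in_free_algebra)
    then show ?thesis by (simp add: lpa_class_eq_iff)
  qed
  then have "congruent (lpa_cong (cartesian_product E F)) (\<lambda>p. lpa_class E (lift p))"
    by (rule congruentI)
  from UN_equiv_class[OF equiv_lpa_cong this assms] show ?thesis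
    by (simp add: proj_def)
qed

sublocale proj: ring_hom_ring "leavitt_path_algebra TYPE('k) (cartesian_product E F)"
  "leavitt_path_algebra TYPE('k) E" proj
proof -
  let ?S = "leavitt_path_algebra TYPE('k) (cartesian_product E F)" and ?R = "leavitt_path_algebra TYPE('k) E"
  have "proj \<in> ring_hom ?S ?R"
    by (rule ring_hom_memI)
      (auto simp: lpa_carrier proj_class lift_in_free_algebra lpa_mult_class lpa_add_class lpa_one
        free_algebra_mult free_algebra_add vertex_sum_in_free_algebra free_lift_mult free_lift_add
        lift_vertex_sum del: equalityI)
  then show "ring_hom_ring ?S ?R proj"
    by (intro ring_hom_ringI2 E.ring_leavitt_path_algebra EF.ring_leavitt_path_algebra)
qed

lemma proj_component:
  "proj ` lpa_component TYPE('k) (cartesian_product E F) d \<subseteq> lpa_component TYPE('k) E d"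
proof -
  have "p \<in> free_algebra (lpa_gens (cartesian_product E F))"
    if "p \<in> homogeneous (cartesian_product E F) d" for p :: "('v \<times> 'w, 'e \<times> 'w + 'v \<times> 'f, 'k) lpa_free"
    using that by (simp add: homogeneous_def)
  then show ?thesis
    by (auto simp: lpa_component_eq proj_class intro: lift_homogeneous)
qed

end

theorem proposition4p13:
  fixes E :: "('v, 'e) pre_digraph" and F :: "('w, 'f) pre_digraph"
  assumes "fin_digraph E" and "\<not> (\<exists>v. is_sink E v)"
    and "fin_digraph F" and "card (verts F) > 1" and "\<exists>w. is_source F w"
  shows
    "(IBN (leavitt_path_algebra TYPE('k::field) E) \<longrightarrow>
      IBN (leavitt_path_algebra TYPE('k) (cartesian_product E F))) \<and>
     (gr_IBN (leavitt_path_algebra TYPE('k) E) (lpa_component TYPE('k) E) \<longrightarrow>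
      gr_IBN (leavitt_path_algebra TYPE('k) (cartesian_product E F))
        (lpa_component TYPE('k) (cartesian_product E F)))"
proof -
  obtain w where "is_source F w"
    using assms(5) by blast
  then interpret column_projection E F w "TYPE('k)"
    using assms by (intro column_projection.intro column_projection_axioms.intro) auto
  show ?thesis
    using proj.IBN_pullback
      proj.gr_IBN_pullback[OF EF.graded_ring_leavitt_path_algebra
        E.graded_ring_leavitt_path_algebra proj_component]
    by blast
qed

end
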